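(* Let $(H,\rho)$ be a complete CAT(0) space with the geodesic extension property and let $A:H\rightrightarrows TH$ be a monotone vector field with the surjectivity condition, with resolvents $J_\lambda$ ($\lambda>0$). Then for every $x\in H$, $$\lim_{\lambda\to0^+}J_\lambda x=P_{\overline{\operatorname{dom}A}}\,x .$$
   Context: Geodesics. In a complete CAT(0) space $(H,\rho)$, $\gamma_{x,y}:[0,1]\to H$ denotes the unique geodesic from $x$ to $y$ parametrized with constant speed $\rho(x,y)$; it is called a zero geodesic if $x=y$. For a normalized geodesic $\gamma$ (i.e. parametrized on $[0,1]$ with constant speed), $\zeta(\gamma)=0$ if $\gamma$ is a zero geodesic and $\zeta(\gamma)=1$ otherwise. $H$ has the geodesic extension property if for all $p,q\in H$ there is $\eta:\mathbb{R}\to H$ with $\eta(0)=p$, $\eta(1)=q$ and $\rho(\eta(s),\eta(t))=\rho(p,q)|s-t|$ for all $s,t\in\mathbb{R}$. For $C\subset H$ nonempty, closed and convex, $P_Cx$ is the unique point of $C$ nearest to $x$; under the hypotheses here $\overline{\operatorname{dom}A}$ is nonempty, closed and convex. Tangent spaces. For $q,r\ne p$, the comparison angle $\overline\angle_p(q,r)$ is the angle at $\bar p$ in a Euclidean triangle $\bar p\bar q\bar r$ with the same side lengths as $p,q,r$; set $\overline\angle_p(p,p)=0$ and $\overline\angle_p(p,r)=\overline\angle_p(r,p)=\pi/2$ for $r\neq p$. The Alexandrov angle of geodesics $\gamma_1,\gamma_2$ issuing from $p$ is $\alpha_p(\gamma_1,\gamma_2)=\lim_{s,t\to0^+}\overline\angle_p(\gamma_1(s),\gamma_2(t))$.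 $S_p$ is the set of normalized geodesics issuing from $p$, modulo the relation $\alpha_p=0$, with induced metric $\angle_p$. $T_pH=([0,\infty)\times S_p)/\!\sim$, where $(t_1,\gamma_1)\sim(t_2,\gamma_2)$ iff either $t_1\zeta(\gamma_1)=t_2\zeta(\gamma_2)=0$, or $t_1\zeta(\gamma_1)=t_2\zeta(\gamma_2)>0$ and $\gamma_1=\gamma_2$ in $S_p$. The class of $(t,\gamma)$ is written $t\gamma$, and $\gamma$ stands for $1\gamma$. Put $g_p(t_1\gamma_1,t_2\gamma_2)=t_1t_2\zeta(\gamma_1)\zeta(\gamma_2)\cos\angle_p(\gamma_1,\gamma_2)$. $TH=\bigcup_{p\in H}T_pH$. Vector fields. A vector field is a set-valued map $A:H\rightrightarrows TH$ with $Ap\subset T_pH$ for all $p$ (possibly empty); $\operatorname{dom}A=\{p: Ap\neq\emptyset\}$. $A$ is monotone if $g_p(\eta,\gamma_{p,q})\le -g_q(\nu,\gamma_{q,p})$ whenever $\eta\in Ap$, $\nu\in Aq$. $A$ satisfies the surjectivity condition if for all $t>0$ and $x\in H$ there is $p\in H$ with $t\rho(p,x)\gamma_{p,x}\in Ap$. For $\lambda>0$, the resolvent is $J_\lambda x=\{z\in H:\lambda^{-1}\rho(z,x)\gamma_{z,x}\in Az\}$, which is a singleton for every $x\in H$ when $A$ is monotone with the surjectivity condition, and is then regarded as a map $J_\lambda:H\to H$. *)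

theory Defs
  imports "HOL-Analysis.Analysis"
begin

text \<open>
  A normalized geodesic is a map on \<open>[0,1]\<close>. It is represented by a total function that is
  \<^const>\<open>undefined\<close> outside \<open>[0,1]\<close>, so that equality of representatives is equality of geodesics.
\<close>

definition norm_geodesic :: "(real \<Rightarrow> 'a::metric_space) \<Rightarrow> bool" where
  "norm_geodesic \<gamma> \<longleftrightarrow> \<gamma> \<in> extensional {0..1} \<and>
     (\<forall>s\<in>{0..1}. \<forall>t\<in>{0..1}. dist (\<gamma> s) (\<gamma> t) = dist (\<gamma> 0) (\<gamma> 1) * \<bar>s - t\<bar>)"

text \<open>
  Two points of a geodesic triangle on different sides lie on sides with a common vertex;
  in the inequality below that vertex is \<open>\<gamma> 0 = \<sigma> 0\<close>. For two points on the same side the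
  comparison inequality is an equality. The comparison triangle is \<open>a b c\<close>.
\<close>

class cat0_space = metric_space +
  assumes geodesic_exists: "\<exists>\<gamma>. norm_geodesic \<gamma> \<and> \<gamma> 0 = x \<and> \<gamma> 1 = y"
    and cat0_inequality:
      "\<lbrakk>norm_geodesic \<gamma>; norm_geodesic \<sigma>; \<gamma> 0 = \<sigma> 0;
        dist a b = dist (\<gamma> 0) (\<gamma> 1); dist a c = dist (\<sigma> 0) (\<sigma> 1); dist b c = dist (\<gamma> 1) (\<sigma> 1);
        s \<in> {0..1}; t \<in> {0..1}\<rbrakk>
       \<Longrightarrow> dist (\<gamma> s) (\<sigma> t) \<le> dist (a + s *\<^sub>R (b - a)) (a + t *\<^sub>R (c - a :: real ^ 2))"

definition geodesic_extension_property :: "'a::metric_space itself \<Rightarrow> bool" where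
  "geodesic_extension_property _ \<longleftrightarrow>
     (\<forall>p q :: 'a. \<exists>\<eta> :: real \<Rightarrow> 'a. \<eta> 0 = p \<and> \<eta> 1 = q \<and>
        (\<forall>s t. dist (\<eta> s) (\<eta> t) = dist p q * \<bar>s - t\<bar>))"

definition geod :: "'a::metric_space \<Rightarrow> 'a \<Rightarrow> real \<Rightarrow> 'a" where
  "geod x y = (THE \<gamma>. norm_geodesic \<gamma> \<and> \<gamma> 0 = x \<and> \<gamma> 1 = y)"

definition zeta :: "(real \<Rightarrow> 'a::metric_space) \<Rightarrow> real" where
  "zeta \<gamma> = (if \<gamma> 0 = \<gamma> 1 then 0 else 1)"

definition nearest_point :: "'a::metric_space set \<Rightarrow> 'a \<Rightarrow> 'a" where
  "nearest_point C x = (THE y. y \<in> C \<and> (\<forall>z\<in>C. dist x y \<le> dist x z))"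


subsection \<open>Angles\<close>

text \<open>The angle at \<open>a\<close> of the triangle \<open>a b c\<close>, for \<open>b\<close> and \<open>c\<close> different from \<open>a\<close>.\<close>

definition euclidean_angle :: "real ^ 2 \<Rightarrow> real ^ 2 \<Rightarrow> real ^ 2 \<Rightarrow> real" where
  "euclidean_angle a b c = arccos (((b - a) \<bullet> (c - a)) / (norm (b - a) * norm (c - a)))"

definition comparison_angle :: "'a::metric_space \<Rightarrow> 'a \<Rightarrow> 'a \<Rightarrow> real" where
  "comparison_angle p q r =
     (if q = p \<and> r = p then 0
      else if q = p \<or> r = p then pi / 2
      else THE \<theta>. \<exists>a b c. dist a b = dist p q \<and> dist a c = dist p r \<and> dist b c = dist q r \<and>
                         \<theta> = euclidean_angle a b c)"

definition alexandrov_angle ::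
    "'a::metric_space \<Rightarrow> (real \<Rightarrow> 'a) \<Rightarrow> (real \<Rightarrow> 'a) \<Rightarrow> real" where
  "alexandrov_angle p \<gamma>1 \<gamma>2 =
     Lim (at_right 0 \<times>\<^sub>F at_right 0) (\<lambda>(s, t). comparison_angle p (\<gamma>1 s) (\<gamma>2 t))"


subsection \<open>The space of directions \<open>S\<^sub>p\<close>\<close>

definition geodesics_from :: "'a::metric_space \<Rightarrow> (real \<Rightarrow> 'a) set" where
  "geodesics_from p = {\<gamma>. norm_geodesic \<gamma> \<and> \<gamma> 0 = p}"

definition direction_rel :: "'a::metric_space \<Rightarrow> ((real \<Rightarrow> 'a) \<times> (real \<Rightarrow> 'a)) set" where
  "direction_rel p = {(\<gamma>1, \<gamma>2). \<gamma>1 \<in> geodesics_from p \<and> \<gamma>2 \<in> geodesics_from p \<and>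
                                 alexandrov_angle p \<gamma>1 \<gamma>2 = 0}"

type_synonym 'a direction = "(real \<Rightarrow> 'a) set"

definition directions :: "'a::metric_space \<Rightarrow> 'a direction set" where
  "directions p = geodesics_from p // direction_rel p"

definition direction :: "'a::metric_space \<Rightarrow> (real \<Rightarrow> 'a) \<Rightarrow> 'a direction" where
  "direction p \<gamma> = direction_rel p `` {\<gamma>}"

text \<open>
  The functions induced on classes by \<^const>\<open>zeta\<close>, by the Alexandrov angle and (below) by the
  formula for \<open>g\<^sub>p\<close> are given as the unique value attained on representatives.
\<close>

definition dir_zeta :: "'a::metric_space direction \<Rightarrow> real" where
  "dir_zeta S = (THE z. \<exists>\<gamma>\<in>S. z = zeta \<gamma>)"

definition dir_angle :: "'a::metric_space \<Rightarrow> 'a direction \<Rightarrow> 'a direction \<Rightarrow> real" where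
  "dir_angle p S1 S2 = (THE \<theta>. \<exists>\<gamma>1\<in>S1. \<exists>\<gamma>2\<in>S2. \<theta> = alexandrov_angle p \<gamma>1 \<gamma>2)"


subsection \<open>Tangent spaces\<close>

definition tangent_rel ::
    "'a::metric_space \<Rightarrow> ((real \<times> 'a direction) \<times> (real \<times> 'a direction)) set" where
  "tangent_rel p =
     {((t1, S1), (t2, S2)). t1 \<ge> 0 \<and> S1 \<in> directions p \<and> t2 \<ge> 0 \<and> S2 \<in> directions p \<and>
        (t1 * dir_zeta S1 = 0 \<and> t2 * dir_zeta S2 = 0 \<or>
         t1 * dir_zeta S1 = t2 * dir_zeta S2 \<and> t2 * dir_zeta S2 > 0 \<and> S1 = S2)}"

text \<open>
  Tangent vectors are equivalence classes. The spaces at distinct base points are disjoint,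
  because each class consists of pairs whose second component is a class of geodesics
  issuing from the base point.
\<close>

type_synonym 'a tangent_vector = "(real \<times> 'a direction) set"

definition tangent_space :: "'a::metric_space \<Rightarrow> 'a tangent_vector set" where
  "tangent_space p = ({0..} \<times> directions p) // tangent_rel p"

text \<open>The tangent vector \<open>t\<gamma>\<close> at \<open>p\<close>.\<close>

definition tangent :: "'a::metric_space \<Rightarrow> real \<Rightarrow> (real \<Rightarrow> 'a) \<Rightarrow> 'a tangent_vector" where
  "tangent p t \<gamma> = tangent_rel p `` {(t, direction p \<gamma>)}"

definition tangent_product ::
    "'a::metric_space \<Rightarrow> 'a tangent_vector \<Rightarrow> 'a tangent_vector \<Rightarrow> real" where
  "tangent_product p u v =
     (THE c. \<exists>(t1, S1)\<in>u. \<exists>(t2, S2)\<in>v.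
        c = t1 * t2 * dir_zeta S1 * dir_zeta S2 * cos (dir_angle p S1 S2))"


subsection \<open>Vector fields\<close>

definition vector_field :: "('a::metric_space \<Rightarrow> 'a tangent_vector set) \<Rightarrow> bool" where
  "vector_field A \<longleftrightarrow> (\<forall>p. A p \<subseteq> tangent_space p)"

definition vf_dom :: "('a::metric_space \<Rightarrow> 'a tangent_vector set) \<Rightarrow> 'a set" where
  "vf_dom A = {p. A p \<noteq> {}}"

definition monotone_vf :: "('a::metric_space \<Rightarrow> 'a tangent_vector set) \<Rightarrow> bool" where
  "monotone_vf A \<longleftrightarrow> (\<forall>p q. \<forall>\<eta>\<in>A p. \<forall>\<nu>\<in>A q.
     tangent_product p \<eta> (tangent p 1 (geod p q))
       \<le> - tangent_product q \<nu> (tangent q 1 (geod q p)))"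

definition surjectivity_condition :: "('a::metric_space \<Rightarrow> 'a tangent_vector set) \<Rightarrow> bool" where
  "surjectivity_condition A \<longleftrightarrow>
     (\<forall>t>0. \<forall>x. \<exists>p. tangent p (t * dist p x) (geod p x) \<in> A p)"

definition resolvent_set ::
    "('a::metric_space \<Rightarrow> 'a tangent_vector set) \<Rightarrow> real \<Rightarrow> 'a \<Rightarrow> 'a set" where
  "resolvent_set A \<mu> x = {z. tangent z (inverse \<mu> * dist z x) (geod z x) \<in> A z}"

definition resolvent ::
    "('a::metric_space \<Rightarrow> 'a tangent_vector set) \<Rightarrow> real \<Rightarrow> 'a \<Rightarrow> 'a" where
  "resolvent A \<mu> x = the_elem (resolvent_set A \<mu> x)"

end

(* The CAT(0) law of cosines at z = J_mu x, combined with monotonicity against a fixed vector of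
   length T at q in dom A, gives
     d(z,x)^2 + d(z,q)^2 <= d(x,q)^2 + 2 mu T d(z,q).
   As d(z,x) is at least D, the distance from x to dom A, it follows that
     d(z,q) <= 2 mu T + sqrt (d(x,q)^2 - D^2).
   So for q in dom A nearly minimizing the distance to x, the resolvents are eventually close to q:
   minimizing sequences in dom A are Cauchy, and J_mu x tends to their common limit. *)
theory Submission
  imports Defs
begin

section \<open>Comparison angles\<close>

text \<open>Tangent vectors are equivalence classes and their products are \<open>THE\<close> values
  over an angle defined by \<open>Lim\<close>, so no estimate is possible before the limit is known
  to exist and to be independent of representatives. Curvature enters through one fact: along two
  geodesics from \<open>p\<close> the comparison angle shrinks towards \<open>p\<close>. Hence the
  Alexandrov angle is at most the comparison angle of the endpoints, and the Euclidean law of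
  cosines survives as an inequality for \<open>tangent_product\<close>. The work is done with the
  cosine \<open>cos_angle\<close>, a quotient of squared distances; \<open>arccos\<close> serves
  only to return to the defined angles. Uniqueness of the nearest point comes from uniqueness of
  limits, because the resolvents converge to every minimizer.\<close>

definition cos_angle :: "'a::metric_space \<Rightarrow> 'a \<Rightarrow> 'a \<Rightarrow> real" where
  "cos_angle p q r = ((dist p q)\<^sup>2 + (dist p r)\<^sup>2 - (dist q r)\<^sup>2) / (2 * dist p q * dist p r)"

text \<open>The triangle inequality, squared, gives the lower bound and its reverse form the upper
  one. They put the quotient in the range where \<open>cos\<close> inverts
  \<open>arccos\<close>.\<close>

lemma cos_angle_bounds:
  assumes "q \<noteq> p" "r \<noteq> p"
  shows "-1 \<le> cos_angle p q r" "cos_angle p q r \<le> 1"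
proof -
  have pos: "0 < 2 * dist p q * dist p r"
    using assms by simp
  have t: "dist q r \<le> dist p q + dist p r" "\<bar>dist p q - dist p r\<bar> \<le> dist q r"
    using dist_triangle[of q r p] dist_triangle[of p q r] dist_triangle[of p r q]
    by (auto simp: dist_commute)
  have "(dist q r)\<^sup>2 \<le> (dist p q + dist p r)\<^sup>2"
    using t(1) by (intro power_mono) auto
  then show "-1 \<le> cos_angle p q r"
    using pos by (simp add: cos_angle_def pos_le_divide_eq power2_eq_square algebra_simps)
  have "\<bar>dist p q - dist p r\<bar>\<^sup>2 \<le> (dist q r)\<^sup>2"
    using t(2) by (intro power_mono) auto
  then show "cos_angle p q r \<le> 1"
    using pos by (simp add: cos_angle_def pos_divide_le_eq power2_eq_square algebra_simps)
qed

lemma law_of_cosines_inner: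
  fixes a b c :: "'b::real_inner"
  shows "2 * ((b - a) \<bullet> (c - a)) = (dist a b)\<^sup>2 + (dist a c)\<^sup>2 - (dist b c)\<^sup>2"
  by (simp add: dist_norm power2_norm_eq_inner inner_diff_left inner_diff_right inner_commute)

lemma euclidean_angle_eq: "euclidean_angle a b c = arccos (cos_angle a b c)"
proof -
  have eq: "(b - a) \<bullet> (c - a) = ((dist a b)\<^sup>2 + (dist a c)\<^sup>2 - (dist b c)\<^sup>2) / 2"
    using law_of_cosines_inner[of b a c] by simp
  show ?thesis
    unfolding euclidean_angle_def cos_angle_def eq by (simp add: dist_norm norm_minus_commute mult.assoc)
qed

text \<open>Both the \<open>THE\<close> in \<open>comparison_angle\<close> and the CAT(0) axiom
  speak of a planar triangle, which has to be supplied. Degenerate triples are included because the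
  CAT(0) inequality is also applied to constant geodesics.\<close>

lemma comparison_triangle_exists:
  fixes p q r :: "'a::metric_space"
  obtains a b c :: "real ^ 2"
  where "dist a b = dist p q" "dist a c = dist p r" "dist b c = dist q r"
proof (cases "q = p \<or> r = p")
  case True
  have ax: "dist 0 (axis 1 w :: real ^ 2) = \<bar>w\<bar>" for w :: real
    by (simp add: dist_norm norm_eq_sqrt_inner inner_axis_axis)
  from True show thesis
  proof
    assume "q = p"
    with that[of 0 0 "axis 1 (dist p r)"] ax show thesis by simp
  next
    assume "r = p"
    with that[of 0 "axis 1 (dist p q)" 0] ax show thesis by (simp add: dist_commute)
  qed
next
  case False
  define k where "k = cos_angle p q r"
  \<comment> \<open>The vertex for \<open>p\<close> is the origin, \<open>b\<close> lies on the
    first axis, and \<open>c\<close> has polar angle with cosine \<open>k\<close>.\<close>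
  define b :: "real ^ 2" where "b = vector [dist p q, 0]"
  define c :: "real ^ 2" where "c = vector [dist p r * k, dist p r * sqrt (1 - k\<^sup>2)]"
  have "\<bar>k\<bar> \<le> 1"
    using cos_angle_bounds[of q p r] False by (auto simp: k_def)
  then have k2: "(sqrt (1 - k\<^sup>2))\<^sup>2 = 1 - k\<^sup>2"
    by (simp add: abs_square_le_1)
  have kk: "2 * dist p q * dist p r * k = (dist p q)\<^sup>2 + (dist p r)\<^sup>2 - (dist q r)\<^sup>2"
    using False by (auto simp: k_def cos_angle_def)
  have bc: "b \<bullet> b = (dist p q)\<^sup>2" "b \<bullet> c = dist p q * dist p r * k"
    by (simp_all add: b_def c_def inner_vec_def sum_2 power2_eq_square)
  have "c \<bullet> c = (dist p r)\<^sup>2 * (k\<^sup>2 + (sqrt (1 - k\<^sup>2))\<^sup>2)"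
    by (simp only: c_def inner_vec_def sum_2 vector_2 inner_real_def) algebra
  then have cc: "c \<bullet> c = (dist p r)\<^sup>2"
    by (simp only: k2) simp
  have "(dist b c)\<^sup>2 = (dist q r)\<^sup>2"
    using kk bc cc law_of_cosines_inner[of b 0 c] by (simp add: dist_norm power2_norm_eq_inner)
  then have "dist b c = dist q r"
    by simp
  moreover have "dist 0 b = dist p q" "dist 0 c = dist p r"
    using bc cc by (simp_all add: dist_norm norm_eq_sqrt_inner)
  ultimately show thesis
    using that by blast
qed

text \<open>The \<open>THE\<close> is well defined: a comparison triangle exists, and its angle
  depends on the side lengths only.\<close>

lemma comparison_angle_eq:
  assumes "q \<noteq> p" "r \<noteq> p"
  shows "comparison_angle p q r = arccos (cos_angle p q r)"
proof -
  obtain a b c :: "real ^ 2"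
    where "dist a b = dist p q" "dist a c = dist p r" "dist b c = dist q r"
    by (rule comparison_triangle_exists)
  then have "\<exists>a b c :: real ^ 2. dist a b = dist p q \<and> dist a c = dist p r \<and> dist b c = dist q r \<and>
      arccos (cos_angle p q r) = euclidean_angle a b c"
    by (intro exI[of _ a] exI[of _ b] exI[of _ c]) (simp add: euclidean_angle_eq cos_angle_def)
  moreover have "\<theta> = arccos (cos_angle p q r)"
    if "\<exists>a b c :: real ^ 2. dist a b = dist p q \<and> dist a c = dist p r \<and> dist b c = dist q r \<and>
      \<theta> = euclidean_angle a b c" for \<theta>
    using that by (auto simp: euclidean_angle_eq cos_angle_def)
  ultimately have "(THE \<theta>. \<exists>a b c. dist a b = dist p q \<and> dist a c = dist p r \<and> dist b c = dist q r \<and>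
      \<theta> = euclidean_angle a b c) = arccos (cos_angle p q r)"
    by (rule the_equality)
  then show ?thesis
    using assms by (simp add: comparison_angle_def)
qed


section \<open>Geodesics in CAT(0) spaces\<close>

lemma norm_geodesic_dist_start:
  assumes "norm_geodesic \<gamma>" "s \<in> {0..1}"
  shows "dist (\<gamma> 0) (\<gamma> s) = s * dist (\<gamma> 0) (\<gamma> 1)"
proof -
  have "dist (\<gamma> 0) (\<gamma> s) = dist (\<gamma> 0) (\<gamma> 1) * \<bar>0 - s\<bar>"
    using assms unfolding norm_geodesic_def by (meson atLeastAtMost_iff order_refl zero_le_one)
  with assms show ?thesis by simp
qed

lemma norm_geodesic_initial_segment:
  assumes "norm_geodesic \<gamma>" "s \<in> {0..1}"
  shows "norm_geodesic (restrict (\<lambda>u. \<gamma> (s * u)) {0..1})"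
proof -
  have mem: "s * u \<in> {0..1}" if "u \<in> {0..1}" for u
    using assms(2) that by (auto intro: mult_le_one)
  have *: "dist (\<gamma> u) (\<gamma> v) = dist (\<gamma> 0) (\<gamma> 1) * \<bar>u - v\<bar>" if "u \<in> {0..1}" "v \<in> {0..1}" for u v
    using assms(1) that unfolding norm_geodesic_def by blast
  have "dist (\<gamma> (s * u)) (\<gamma> (s * v)) = dist (\<gamma> 0) (\<gamma> s) * \<bar>u - v\<bar>"
    if "u \<in> {0..1}" "v \<in> {0..1}" for u v
    using *[OF mem[OF that(1)] mem[OF that(2)]] *[of 0 s] assms(2)
    by (simp add: abs_mult flip: right_diff_distrib)
  then show ?thesis
    by (simp add: norm_geodesic_def)
qed

text \<open>Expanding the squared planar distance with the vertex \<open>a\<close> as origin leaves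
  one inner product, which the law of cosines turns into side lengths. The comparison triangle
  thereby disappears from all later arguments.\<close>

lemma cat0_inequality_squared:
  fixes \<gamma> \<sigma> :: "real \<Rightarrow> 'a::cat0_space"
  assumes "norm_geodesic \<gamma>" "norm_geodesic \<sigma>" "\<gamma> 0 = p" "\<sigma> 0 = p" "s \<in> {0..1}" "t \<in> {0..1}"
  shows "(dist (\<gamma> s) (\<sigma> t))\<^sup>2 \<le> s\<^sup>2 * (dist p (\<gamma> 1))\<^sup>2 + t\<^sup>2 * (dist p (\<sigma> 1))\<^sup>2
     - s * t * ((dist p (\<gamma> 1))\<^sup>2 + (dist p (\<sigma> 1))\<^sup>2 - (dist (\<gamma> 1) (\<sigma> 1))\<^sup>2)"
proof -
  obtain a b c :: "real ^ 2"
    where abc: "dist a b = dist p (\<gamma> 1)" "dist a c = dist p (\<sigma> 1)" "dist b c = dist (\<gamma> 1) (\<sigma> 1)"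
    by (rule comparison_triangle_exists)
  have "(dist (\<gamma> s) (\<sigma> t))\<^sup>2 \<le> (dist (a + s *\<^sub>R (b - a)) (a + t *\<^sub>R (c - a)))\<^sup>2"
    using cat0_inequality[of \<gamma> \<sigma> a b c s t] assms abc by (intro power_mono) auto
  also have "\<dots> = (norm (s *\<^sub>R (b - a) - t *\<^sub>R (c - a)))\<^sup>2"
    by (simp add: dist_norm)
  also have "\<dots> = s\<^sup>2 * (dist a b)\<^sup>2 + t\<^sup>2 * (dist a c)\<^sup>2 - s * t * (2 * ((b - a) \<bullet> (c - a)))"
  proof -
    have "(norm (s *\<^sub>R u - t *\<^sub>R v))\<^sup>2 = s\<^sup>2 * (u \<bullet> u) + t\<^sup>2 * (v \<bullet> v) - s * t * (2 * (u \<bullet> v))"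
      for u v :: "real ^ 2"
      unfolding power2_norm_eq_inner
      by (simp add: inner_diff_left inner_diff_right inner_commute[of v u] power2_eq_square
          algebra_simps)
    then show ?thesis
      by (simp add: dist_norm power2_norm_eq_inner norm_minus_commute[of a])
  qed
  finally show ?thesis
    by (simp only: law_of_cosines_inner abc)
qed

text \<open>With common endpoints the comparison triangle collapses to a segment, so points of equal
  parameter have the same comparison point. Extensionality settles the values outside the unit
  interval.\<close>

lemma norm_geodesic_unique:
  fixes \<gamma> \<sigma> :: "real \<Rightarrow> 'a::cat0_space"
  assumes "norm_geodesic \<gamma>" "norm_geodesic \<sigma>" "\<gamma> 0 = \<sigma> 0" "\<gamma> 1 = \<sigma> 1"
  shows "\<gamma> = \<sigma>"
proof (rule extensionalityI)
  show "\<gamma> \<in> extensional {0..1}" "\<sigma> \<in> extensional {0..1}"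
    using assms unfolding norm_geodesic_def by blast+
  fix s :: real assume "s \<in> {0..1}"
  then have "(dist (\<gamma> s) (\<sigma> s))\<^sup>2 \<le> 0"
    using cat0_inequality_squared[OF assms(1,2), of "\<sigma> 0" s s] assms(3,4)
    by (simp add: power2_eq_square)
  then show "\<gamma> s = \<sigma> s" by simp
qed

lemma geod_properties:
  fixes x y :: "'a::cat0_space"
  shows "norm_geodesic (geod x y)" "geod x y 0 = x" "geod x y 1 = y"
proof -
  have "\<exists>!\<gamma>. norm_geodesic \<gamma> \<and> \<gamma> 0 = x \<and> \<gamma> 1 = y"
    using geodesic_exists[of x y] norm_geodesic_unique by metis
  from theI'[OF this, folded geod_def]
  show "norm_geodesic (geod x y)" "geod x y 0 = x" "geod x y 1 = y" by blast+
qed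

lemma geodesics_fromD:
  assumes "\<gamma> \<in> geodesics_from p"
  shows "norm_geodesic \<gamma>" "\<gamma> 0 = p"
  using assms by (simp_all add: geodesics_from_def)

lemma geod_mem_geodesics_from: "geod x y \<in> geodesics_from (x :: 'a::cat0_space)"
  by (simp add: geodesics_from_def geod_properties)

lemma zeta_geod: "zeta (geod x y) = (if x = (y :: 'a::cat0_space) then 0 else 1)"
  by (simp add: zeta_def geod_properties)

lemma geodesics_from_eq_start_iff:
  assumes "\<gamma> \<in> geodesics_from p" "s \<in> {0<..1}"
  shows "\<gamma> s = p \<longleftrightarrow> zeta \<gamma> = 0"
proof -
  have "dist p (\<gamma> s) = s * dist p (\<gamma> 1)"
    using norm_geodesic_dist_start[of \<gamma> s] geodesics_fromD[OF assms(1)] assms(2) by auto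
  then have "dist p (\<gamma> s) = 0 \<longleftrightarrow> dist p (\<gamma> 1) = 0"
    using assms(2) by auto
  then show ?thesis
    using geodesics_fromD[OF assms(1)] by (auto simp: zeta_def)
qed


section \<open>Alexandrov angles\<close>

text \<open>The squared CAT(0) inequality bounds the numerator for the shortened sides below by
  \<open>s * t\<close> times the numerator for the full sides; the denominators scale by the same
  factor, which cancels.\<close>

lemma cos_angle_mono_endpoints:
  fixes \<gamma> \<sigma> :: "real \<Rightarrow> 'a::cat0_space"
  assumes g: "\<gamma> \<in> geodesics_from p" "\<sigma> \<in> geodesics_from p" "zeta \<gamma> \<noteq> 0" "zeta \<sigma> \<noteq> 0"
    and s: "s \<in> {0<..1}" "t \<in> {0<..1}"
  shows "cos_angle p (\<gamma> 1) (\<sigma> 1) \<le> cos_angle p (\<gamma> s) (\<sigma> t)"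
proof -
  note G = geodesics_fromD[OF g(1)] and S = geodesics_fromD[OF g(2)]
  have "\<gamma> 1 \<noteq> p" "\<sigma> 1 \<noteq> p"
    using geodesics_from_eq_start_iff[of _ p 1] g by auto
  then obtain a b where ab: "a = dist p (\<gamma> 1)" "b = dist p (\<sigma> 1)" "a > 0" "b > 0"
    by simp
  have ds: "dist p (\<gamma> s) = s * a" "dist p (\<sigma> t) = t * b"
    using norm_geodesic_dist_start[of \<gamma> s] norm_geodesic_dist_start[of \<sigma> t] G S s ab by auto
  define K where "K = a\<^sup>2 + b\<^sup>2 - (dist (\<gamma> 1) (\<sigma> 1))\<^sup>2"
  have "(dist (\<gamma> s) (\<sigma> t))\<^sup>2 \<le> s\<^sup>2 * a\<^sup>2 + t\<^sup>2 * b\<^sup>2 - s * t * K"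
    using cat0_inequality_squared[OF G(1) S(1) G(2) S(2), of s t] s ab by (simp add: K_def)
  then have "s * t * K \<le> (s * a)\<^sup>2 + (t * b)\<^sup>2 - (dist (\<gamma> s) (\<sigma> t))\<^sup>2"
    by (simp add: power_mult_distrib)
  then have "s * t * K / (2 * (s * a) * (t * b)) \<le> cos_angle p (\<gamma> s) (\<sigma> t)"
    using ab s unfolding cos_angle_def ds by (intro divide_right_mono) auto
  moreover have "s * t * K / (2 * (s * a) * (t * b)) = K / (2 * a * b)"
    using ab s by (simp add: field_simps)
  ultimately show ?thesis
    using ab by (simp add: cos_angle_def K_def)
qed

text \<open>The initial segments up to \<open>s'\<close> and \<open>t'\<close>, rescaled to the unit
  interval, are again geodesics from \<open>p\<close>; the endpoint version applies to them at the
  parameters \<open>s / s'\<close> and \<open>t / t'\<close>.\<close>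

lemma cos_angle_mono:
  fixes \<gamma> \<sigma> :: "real \<Rightarrow> 'a::cat0_space"
  assumes g: "\<gamma> \<in> geodesics_from p" "\<sigma> \<in> geodesics_from p" "zeta \<gamma> \<noteq> 0" "zeta \<sigma> \<noteq> 0"
    and s: "0 < s" "s \<le> s'" "s' \<le> 1" "0 < t" "t \<le> t'" "t' \<le> 1"
  shows "cos_angle p (\<gamma> s') (\<sigma> t') \<le> cos_angle p (\<gamma> s) (\<sigma> t)"
proof -
  let ?g = "restrict (\<lambda>u. \<gamma> (s' * u)) {0..1}" and ?h = "restrict (\<lambda>u. \<sigma> (t' * u)) {0..1}"
  have "?g \<in> geodesics_from p" "?h \<in> geodesics_from p"
    using geodesics_fromD[OF g(1)] geodesics_fromD[OF g(2)] s
    by (simp_all add: geodesics_from_def norm_geodesic_initial_segment)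
  moreover have "zeta ?g \<noteq> 0" "zeta ?h \<noteq> 0"
    using geodesics_from_eq_start_iff[OF g(1), of s'] geodesics_from_eq_start_iff[OF g(2), of t']
      geodesics_fromD[OF g(1)] geodesics_fromD[OF g(2)] g(3,4) s
    by (auto simp: zeta_def)
  moreover have "s / s' \<in> {0<..1}" "t / t' \<in> {0<..1}"
    using s by auto
  ultimately have "cos_angle p (?g 1) (?h 1) \<le> cos_angle p (?g (s / s')) (?h (t / t'))"
    by (rule cos_angle_mono_endpoints)
  then show ?thesis
    using s by simp
qed

section \<open>Existence of the Alexandrov angle as a monotone limit\<close>

lemma at_right_prod_neq_bot: "at_right (0::real) \<times>\<^sub>F at_right (0::real) \<noteq> bot"
  by (simp add: prod_filter_eq_bot trivial_limit_at_right_real)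

lemma eventually_at_right_prod_le:
  assumes "s0 > (0::real)" "t0 > (0::real)"
  shows "eventually (\<lambda>(s, t). 0 < s \<and> s \<le> s0 \<and> 0 < t \<and> t \<le> t0) (at_right 0 \<times>\<^sub>F at_right 0)"
proof -
  have ev: "eventually (\<lambda>s. 0 < s \<and> s \<le> c) (at_right (0::real))" if "c > 0" for c
    using that by (auto simp: eventually_at_right_field intro!: exI[of _ c])
  show ?thesis
    unfolding eventually_prod_filter using ev[OF assms(1)] ev[OF assms(2)] by blast
qed

text \<open>The cosine is bounded and increases as both parameters decrease, so it tends to its
  supremum \<open>L\<close>. The second claim is the supremum bound at parameters (1, 1), the source
  of every later law of cosines; the third lets angles be recovered from their cosines.\<close>

lemma alexandrov_angle_limit:
  fixes \<gamma> \<sigma> :: "real \<Rightarrow> 'a::cat0_space"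
  assumes g: "\<gamma> \<in> geodesics_from p" "\<sigma> \<in> geodesics_from p" "zeta \<gamma> \<noteq> 0" "zeta \<sigma> \<noteq> 0"
  shows "((\<lambda>(s, t). cos_angle p (\<gamma> s) (\<sigma> t)) \<longlongrightarrow> cos (alexandrov_angle p \<gamma> \<sigma>))
           (at_right 0 \<times>\<^sub>F at_right 0)" (is ?lim)
    and "cos_angle p (\<gamma> 1) (\<sigma> 1) \<le> cos (alexandrov_angle p \<gamma> \<sigma>)" (is ?le)
    and "alexandrov_angle p \<gamma> \<sigma> \<in> {0..pi}" (is ?mem)
proof -
  let ?F = "at_right (0::real) \<times>\<^sub>F at_right (0::real)"
  let ?f = "\<lambda>(s, t). cos_angle p (\<gamma> s) (\<sigma> t)"
  let ?I = "{0<..1::real} \<times> {0<..1::real}"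
  define L where "L = (SUP z\<in>?I. ?f z)"
  have ne: "\<gamma> s \<noteq> p" "\<sigma> s \<noteq> p" if "s \<in> {0<..1}" for s
    using geodesics_from_eq_start_iff[of _ p s] g that by auto
  have bd: "-1 \<le> ?f z" "?f z \<le> 1" if "z \<in> ?I" for z
    using that cos_angle_bounds[OF ne, of "fst z" "snd z"] by auto
  have bdd: "bdd_above (?f ` ?I)"
    using bd(2) by (intro bdd_aboveI[of _ 1]) blast
  have upper: "?f z \<le> L" if "z \<in> ?I" for z
    unfolding L_def by (rule cSUP_upper[OF that bdd])
  have L1: "L \<le> 1"
    unfolding L_def by (rule cSUP_least) (use bd in auto)
  have L0: "-1 \<le> L"
    using bd(1)[of "(1, 1)"] upper[of "(1, 1)"] by simp
  have evI: "eventually (\<lambda>z. z \<in> ?I) ?F"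
    using eventually_at_right_prod_le[of 1 1] by (rule eventually_mono) auto
  have lim: "(?f \<longlongrightarrow> L) ?F"
  proof (rule order_tendstoI)
    fix l assume "l < L"
    then obtain z where z: "z \<in> ?I" "l < ?f z"
      unfolding L_def by (subst (asm) less_cSUP_iff[OF _ bdd]) auto
    obtain s0 t0 where st: "z = (s0, t0)" by force
    have "eventually (\<lambda>(s, t). 0 < s \<and> s \<le> s0 \<and> 0 < t \<and> t \<le> t0) ?F"
      by (rule eventually_at_right_prod_le) (use z st in auto)
    then show "eventually (\<lambda>z. l < ?f z) ?F"
    proof (rule eventually_mono, clarify)
      fix s t assume "0 < s" "s \<le> s0" "0 < t" "t \<le> t0"
      then have "cos_angle p (\<gamma> s0) (\<sigma> t0) \<le> cos_angle p (\<gamma> s) (\<sigma> t)"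
        using z st by (intro cos_angle_mono[OF g]) auto
      then show "l < cos_angle p (\<gamma> s) (\<sigma> t)"
        using z st by simp
    qed
  next
    fix l assume "L < l"
    show "eventually (\<lambda>z. ?f z < l) ?F"
      using evI by (rule eventually_mono) (use upper \<open>L < l\<close> in \<open>meson le_less_trans\<close>)
  qed
  have "((\<lambda>z. arccos (?f z)) \<longlongrightarrow> arccos L) ?F"
    by (rule continuous_on_tendsto_compose[OF continuous_on_arccos' lim])
      (use L0 L1 evI bd in \<open>auto elim!: eventually_mono\<close>)
  then have "((\<lambda>(s, t). comparison_angle p (\<gamma> s) (\<sigma> t)) \<longlongrightarrow> arccos L) ?F"
  proof (rule Lim_transform_eventually)
    show "eventually (\<lambda>z. arccos (?f z) = (case z of (s, t) \<Rightarrow> comparison_angle p (\<gamma> s) (\<sigma> t))) ?F"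
      using evI by (rule eventually_mono) (auto simp: comparison_angle_eq ne)
  qed
  then have eq: "alexandrov_angle p \<gamma> \<sigma> = arccos L"
    unfolding alexandrov_angle_def by (intro tendsto_Lim at_right_prod_neq_bot)
  with lim L0 L1 show ?lim
    by simp
  show ?le
    using upper[of "(1, 1)"] L0 L1 eq by simp
  show ?mem
    using L0 L1 eq arccos_lbound arccos_ubound by simp
qed

text \<open>The convention pi/2 for a pair containing the base point keeps zero and nonzero
  geodesics in different directions, so that \<open>zeta\<close> is constant on each class.\<close>

lemma alexandrov_angle_zero_nonzero:
  assumes g: "\<gamma> \<in> geodesics_from p" "\<sigma> \<in> geodesics_from p" and "zeta \<gamma> \<noteq> zeta \<sigma>"
  shows "alexandrov_angle p \<gamma> \<sigma> = pi / 2"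
proof -
  have z: "zeta \<gamma> = 0 \<longleftrightarrow> zeta \<sigma> \<noteq> 0"
    using assms(3) by (auto simp: zeta_def split: if_splits)
  have "comparison_angle p (\<gamma> s) (\<sigma> t) = pi / 2" if "s \<in> {0<..1}" "t \<in> {0<..1}" for s t
    using geodesics_from_eq_start_iff[OF g(1) that(1)] geodesics_from_eq_start_iff[OF g(2) that(2)]
      z by (auto simp: comparison_angle_def)
  then have "eventually (\<lambda>z. (case z of (s, t) \<Rightarrow> comparison_angle p (\<gamma> s) (\<sigma> t)) = pi / 2)
      (at_right 0 \<times>\<^sub>F at_right 0)"
    using eventually_at_right_prod_le[of 1 1] by (auto elim!: eventually_mono)
  then show ?thesis
    unfolding alexandrov_angle_def by (intro tendsto_Lim at_right_prod_neq_bot tendsto_eventually)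
qed

text \<open>The two parameters vary independently, so the limit compares different points of the
  geodesic. The bound at the endpoints already forces cosine 1. This is reflexivity of
  \<open>direction_rel\<close>, which puts a geodesic into its own class.\<close>

lemma alexandrov_angle_self:
  fixes \<gamma> :: "real \<Rightarrow> 'a::cat0_space"
  assumes g: "\<gamma> \<in> geodesics_from p"
  shows "alexandrov_angle p \<gamma> \<gamma> = 0"
proof (cases "zeta \<gamma> = 0")
  case True
  then have "comparison_angle p (\<gamma> s) (\<gamma> t) = 0" if "s \<in> {0<..1}" "t \<in> {0<..1}" for s t
    using geodesics_from_eq_start_iff[OF g] that by (auto simp: comparison_angle_def)
  then have "eventually (\<lambda>z. (case z of (s, t) \<Rightarrow> comparison_angle p (\<gamma> s) (\<gamma> t)) = 0)
      (at_right 0 \<times>\<^sub>F at_right 0)"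
    using eventually_at_right_prod_le[of 1 1] by (auto elim!: eventually_mono)
  then show ?thesis
    unfolding alexandrov_angle_def by (intro tendsto_Lim at_right_prod_neq_bot tendsto_eventually)
next
  case False
  then have "\<gamma> 1 \<noteq> p"
    using geodesics_from_eq_start_iff[OF g, of 1] by simp
  then have "cos_angle p (\<gamma> 1) (\<gamma> 1) = 1"
    by (simp add: cos_angle_def power2_eq_square)
  then have "cos (alexandrov_angle p \<gamma> \<gamma>) = 1"
    using alexandrov_angle_limit(2)[OF g g False False] by (simp add: antisym)
  then show ?thesis
    using alexandrov_angle_limit(3)[OF g g False False] cos_inj_pi[of "alexandrov_angle p \<gamma> \<gamma>" 0]
    by simp
qed

text \<open>
  Along unit-speed parametrizations the comparison triangles are isosceles, so the angle is
  determined by the limit of distance over time; this makes replacing a geodesic by one at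
  angle zero a matter of the triangle inequality for \<^const>\<open>dist\<close>.
\<close>

lemma tendsto_dist_unit_speed:
  fixes \<gamma> \<sigma> :: "real \<Rightarrow> 'a::cat0_space"
  assumes g: "\<gamma> \<in> geodesics_from p" "\<sigma> \<in> geodesics_from p" "zeta \<gamma> \<noteq> 0" "zeta \<sigma> \<noteq> 0"
  shows "((\<lambda>r. dist (\<gamma> (r / dist p (\<gamma> 1))) (\<sigma> (r / dist p (\<sigma> 1))) / r)
           \<longlongrightarrow> sqrt (2 * (1 - cos (alexandrov_angle p \<gamma> \<sigma>)))) (at_right 0)"
proof -
  have "\<gamma> 1 \<noteq> p" "\<sigma> 1 \<noteq> p"
    using geodesics_from_eq_start_iff[of _ p 1] g by auto
  then obtain a b where ab: "a = dist p (\<gamma> 1)" "b = dist p (\<sigma> 1)" "a > 0" "b > 0"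
    by simp
  have scale: "filterlim (\<lambda>r. r / c) (at_right 0) (at_right 0)" if "c > 0" for c :: real
  proof (rule tendsto_imp_filterlim_at_right)
    have "((\<lambda>r. r / c) \<longlongrightarrow> 0 / c) (at_right 0)"
      by (intro tendsto_intros) (use that in auto)
    then show "((\<lambda>r. r / c) \<longlongrightarrow> 0) (at_right 0)" by simp
    show "eventually (\<lambda>r. 0 < r / c) (at_right 0)"
      using that by (auto simp: eventually_at_right_field intro!: exI[of _ 1])
  qed
  have "filterlim (\<lambda>r. (r / a, r / b)) (at_right 0 \<times>\<^sub>F at_right 0) (at_right 0)"
    by (intro filterlim_Pair scale ab)
  from filterlim_compose[OF alexandrov_angle_limit(1)[OF g] this]
  have "((\<lambda>r. cos_angle p (\<gamma> (r / a)) (\<sigma> (r / b))) \<longlongrightarrow> cos (alexandrov_angle p \<gamma> \<sigma>)) (at_right 0)"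
    by simp
  then have "((\<lambda>r. sqrt (2 * (1 - cos_angle p (\<gamma> (r / a)) (\<sigma> (r / b)))))
      \<longlongrightarrow> sqrt (2 * (1 - cos (alexandrov_angle p \<gamma> \<sigma>)))) (at_right 0)"
    by (intro tendsto_intros)
  moreover have "eventually (\<lambda>r. sqrt (2 * (1 - cos_angle p (\<gamma> (r / a)) (\<sigma> (r / b))))
      = dist (\<gamma> (r / a)) (\<sigma> (r / b)) / r) (at_right 0)"
  proof -
    \<comment> \<open>This keeps \<open>r / a\<close> and \<open>r / b\<close> in the unit interval,
      where both curves have constant speed.\<close>
    have "eventually (\<lambda>r. 0 < r \<and> r < min a b) (at_right 0)"
      using ab by (auto simp: eventually_at_right_field intro!: exI[of _ "min a b"])
    then show ?thesis
    proof (rule eventually_mono)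
      fix r assume r: "0 < r \<and> r < min a b"
      have ds: "dist p (\<gamma> (r / a)) = r" "dist p (\<sigma> (r / b)) = r"
        using norm_geodesic_dist_start[of \<gamma> "r / a"] norm_geodesic_dist_start[of \<sigma> "r / b"]
          geodesics_fromD[OF g(1)] geodesics_fromD[OF g(2)] r ab by auto
      have "2 * (1 - cos_angle p (\<gamma> (r / a)) (\<sigma> (r / b))) = (dist (\<gamma> (r / a)) (\<sigma> (r / b)) / r)\<^sup>2"
        using r unfolding cos_angle_def ds by (simp add: field_simps power2_eq_square)
      then show "sqrt (2 * (1 - cos_angle p (\<gamma> (r / a)) (\<sigma> (r / b))))
          = dist (\<gamma> (r / a)) (\<sigma> (r / b)) / r"
        using r by simp
    qed
  qed
  ultimately show ?thesis
    unfolding ab(1,2) by (rule Lim_transform_eventually)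
qed

text \<open>This makes \<open>dir_angle\<close> well defined. Angle zero means that the two
  geodesics separate by o(r) at distance r from \<open>p\<close>, so swapping representatives
  changes the chord by o(r) and leaves the limit unchanged.\<close>

lemma alexandrov_angle_cong:
  fixes \<gamma> \<gamma>' \<sigma> \<sigma>' :: "real \<Rightarrow> 'a::cat0_space"
  assumes g: "\<gamma> \<in> geodesics_from p" "\<gamma>' \<in> geodesics_from p" "zeta \<gamma> \<noteq> 0" "zeta \<gamma>' \<noteq> 0"
    and h: "\<sigma> \<in> geodesics_from p" "\<sigma>' \<in> geodesics_from p" "zeta \<sigma> \<noteq> 0" "zeta \<sigma>' \<noteq> 0"
    and z: "alexandrov_angle p \<gamma> \<gamma>' = 0" "alexandrov_angle p \<sigma> \<sigma>' = 0"
  shows "alexandrov_angle p \<gamma>' \<sigma>' = alexandrov_angle p \<gamma> \<sigma>"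
proof -
  define u where "u \<tau> r = \<tau> (r / dist p (\<tau> 1))" for \<tau> :: "real \<Rightarrow> 'a" and r
  have lim: "((\<lambda>r. dist (u \<tau> r) (u \<upsilon> r) / r) \<longlongrightarrow> sqrt (2 * (1 - cos (alexandrov_angle p \<tau> \<upsilon>))))
      (at_right 0)"
    if "\<tau> \<in> geodesics_from p" "\<upsilon> \<in> geodesics_from p" "zeta \<tau> \<noteq> 0" "zeta \<upsilon> \<noteq> 0" for \<tau> \<upsilon>
    unfolding u_def by (rule tendsto_dist_unit_speed[OF that])
  let ?e = "\<lambda>r. dist (u \<gamma>' r) (u \<sigma>' r) / r - dist (u \<gamma> r) (u \<sigma> r) / r"
  have "((\<lambda>r. dist (u \<gamma> r) (u \<gamma>' r) / r) \<longlongrightarrow> 0) (at_right 0)"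
    using lim[OF g] unfolding z by simp
  moreover have "((\<lambda>r. dist (u \<sigma> r) (u \<sigma>' r) / r) \<longlongrightarrow> 0) (at_right 0)"
    using lim[OF h] unfolding z by simp
  ultimately have "((\<lambda>r. dist (u \<gamma> r) (u \<gamma>' r) / r + dist (u \<sigma> r) (u \<sigma>' r) / r) \<longlongrightarrow> 0) (at_right 0)"
    by (rule tendsto_add_zero)
  moreover have "eventually (\<lambda>r. norm (?e r) \<le>
      dist (u \<gamma> r) (u \<gamma>' r) / r + dist (u \<sigma> r) (u \<sigma>' r) / r) (at_right 0)"
    using eventually_at_right_less[of "0::real"]
  proof (rule eventually_mono)
    fix r :: real assume "0 < r"
    have "\<bar>dist (u \<gamma>' r) (u \<sigma>' r) - dist (u \<gamma> r) (u \<sigma> r)\<bar>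
        \<le> dist (u \<gamma> r) (u \<gamma>' r) + dist (u \<sigma> r) (u \<sigma>' r)"
      using dist_triangle[of "u \<gamma> r" "u \<sigma> r" "u \<gamma>' r"] dist_triangle[of "u \<gamma>' r" "u \<sigma> r" "u \<sigma>' r"]
        dist_commute[of "u \<gamma>' r" "u \<gamma> r"] dist_commute[of "u \<sigma>' r" "u \<sigma> r"]
        dist_triangle[of "u \<gamma>' r" "u \<sigma>' r" "u \<gamma> r"] dist_triangle[of "u \<gamma> r" "u \<sigma>' r" "u \<sigma> r"]
      by linarith
    then have "\<bar>dist (u \<gamma>' r) (u \<sigma>' r) - dist (u \<gamma> r) (u \<sigma> r)\<bar> / r
        \<le> (dist (u \<gamma> r) (u \<gamma>' r) + dist (u \<sigma> r) (u \<sigma>' r)) / r"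
      using \<open>0 < r\<close> by (intro divide_right_mono) auto
    moreover have "norm (?e r) = \<bar>dist (u \<gamma>' r) (u \<sigma>' r) - dist (u \<gamma> r) (u \<sigma> r)\<bar> / r"
      using \<open>0 < r\<close> by (simp only: real_norm_def diff_divide_distrib[symmetric] abs_divide abs_of_pos)
    ultimately show "norm (?e r) \<le> dist (u \<gamma> r) (u \<gamma>' r) / r + dist (u \<sigma> r) (u \<sigma>' r) / r"
      by (simp only: add_divide_distrib)
  qed
  ultimately have "(?e \<longlongrightarrow> 0) (at_right 0)"
    by (rule Lim_null_comparison[rotated])
  moreover have "(?e \<longlongrightarrow> sqrt (2 * (1 - cos (alexandrov_angle p \<gamma>' \<sigma>')))
      - sqrt (2 * (1 - cos (alexandrov_angle p \<gamma> \<sigma>)))) (at_right 0)"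
    by (rule tendsto_diff[OF lim[OF g(2) h(2) g(4) h(4)] lim[OF g(1) h(1) g(3) h(3)]])
  ultimately have "0 = sqrt (2 * (1 - cos (alexandrov_angle p \<gamma>' \<sigma>')))
      - sqrt (2 * (1 - cos (alexandrov_angle p \<gamma> \<sigma>)))"
    by (rule tendsto_unique[OF trivial_limit_at_right_real])
  then have "cos (alexandrov_angle p \<gamma>' \<sigma>') = cos (alexandrov_angle p \<gamma> \<sigma>)"
    by simp
  moreover have "alexandrov_angle p \<gamma>' \<sigma>' \<in> {0..pi}" "alexandrov_angle p \<gamma> \<sigma> \<in> {0..pi}"
    by (rule alexandrov_angle_limit(3)[OF g(2) h(2) g(4) h(4)],
        rule alexandrov_angle_limit(3)[OF g(1) h(1) g(3) h(3)])
  ultimately show ?thesis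
    by (simp add: cos_inj_pi)
qed


section \<open>The product on tangent spaces\<close>

lemma direction_mem_directions: "\<gamma> \<in> geodesics_from p \<Longrightarrow> direction p \<gamma> \<in> directions p"
  by (simp add: direction_def directions_def quotientI)

lemma mem_direction_self:
  "\<gamma> \<in> geodesics_from p \<Longrightarrow> \<gamma> \<in> direction p (\<gamma> :: real \<Rightarrow> 'a::cat0_space)"
  by (simp add: direction_def direction_rel_def alexandrov_angle_self)

lemma mem_directionD:
  assumes "\<gamma>' \<in> direction p \<gamma>"
  shows "\<gamma> \<in> geodesics_from p" "\<gamma>' \<in> geodesics_from p" "alexandrov_angle p \<gamma> \<gamma>' = 0"
    "zeta \<gamma>' = zeta \<gamma>"
proof -
  show *: "\<gamma> \<in> geodesics_from p" "\<gamma>' \<in> geodesics_from p" "alexandrov_angle p \<gamma> \<gamma>' = 0"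
    using assms by (auto simp: direction_def direction_rel_def)
  then show "zeta \<gamma>' = zeta \<gamma>"
    using alexandrov_angle_zero_nonzero[of \<gamma> p \<gamma>'] by fastforce
qed

lemma dir_zeta_direction:
  fixes \<gamma> :: "real \<Rightarrow> 'a::cat0_space"
  assumes "\<gamma> \<in> geodesics_from p"
  shows "dir_zeta (direction p \<gamma>) = zeta \<gamma>"
  unfolding dir_zeta_def
  by (rule the_equality) (use mem_direction_self[OF assms] mem_directionD(4) in auto)

lemma dir_zeta_bounds:
  fixes S :: "'a::cat0_space direction"
  assumes "S \<in> directions p"
  shows "0 \<le> dir_zeta S" "dir_zeta S \<le> 1"
proof -
  obtain \<gamma> where "\<gamma> \<in> geodesics_from p" "S = direction p \<gamma>"
    using assms by (auto simp: directions_def direction_def elim!: quotientE)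
  then show "0 \<le> dir_zeta S" "dir_zeta S \<le> 1"
    by (simp_all add: dir_zeta_direction zeta_def)
qed

text \<open>Nonzero geodesics are the case that matters: in \<open>tangent_product\<close> a zero
  direction kills the cosine through its \<open>dir_zeta\<close> factor.\<close>

lemma dir_angle_direction:
  fixes \<gamma> \<sigma> :: "real \<Rightarrow> 'a::cat0_space"
  assumes "\<gamma> \<in> geodesics_from p" "\<sigma> \<in> geodesics_from p" "zeta \<gamma> \<noteq> 0" "zeta \<sigma> \<noteq> 0"
  shows "dir_angle p (direction p \<gamma>) (direction p \<sigma>) = alexandrov_angle p \<gamma> \<sigma>"
  unfolding dir_angle_def
proof (rule the_equality)
  show "\<exists>\<gamma>1\<in>direction p \<gamma>. \<exists>\<gamma>2\<in>direction p \<sigma>.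
      alexandrov_angle p \<gamma> \<sigma> = alexandrov_angle p \<gamma>1 \<gamma>2"
    using assms mem_direction_self by blast
next
  fix \<theta> assume "\<exists>\<gamma>1\<in>direction p \<gamma>. \<exists>\<gamma>2\<in>direction p \<sigma>. \<theta> = alexandrov_angle p \<gamma>1 \<gamma>2"
  then obtain \<gamma>1 \<gamma>2 where "\<gamma>1 \<in> direction p \<gamma>" "\<gamma>2 \<in> direction p \<sigma>" "\<theta> = alexandrov_angle p \<gamma>1 \<gamma>2"
    by blast
  with assms mem_directionD[of \<gamma>1 p \<gamma>] mem_directionD[of \<gamma>2 p \<sigma>]
  show "\<theta> = alexandrov_angle p \<gamma> \<sigma>"
    by (auto intro: alexandrov_angle_cong[of \<gamma> p \<gamma>1 \<sigma> \<gamma>2])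
qed

text \<open>Related pairs share the number \<open>t * dir_zeta S\<close>, and they share the
  direction unless this number is 0, in which case the cosine is multiplied by 0. So the value does
  not depend on the representatives.\<close>

lemma tangent_product_eq:
  fixes S1 S2 :: "'a::cat0_space direction"
  assumes "0 \<le> t1" "0 \<le> t2" "S1 \<in> directions p" "S2 \<in> directions p"
  shows "tangent_product p (tangent_rel p `` {(t1, S1)}) (tangent_rel p `` {(t2, S2)})
     = t1 * t2 * dir_zeta S1 * dir_zeta S2 * cos (dir_angle p S1 S2)"
proof -
  have refl: "(t, S) \<in> tangent_rel p `` {(t, S)}" if "0 \<le> t" "S \<in> directions p"
    for t and S :: "'a direction"
    using that dir_zeta_bounds(1)[OF that(2)] by (auto simp: tangent_rel_def less_le)
  have rep: "t' * dir_zeta S' = t * dir_zeta S \<and> (t * dir_zeta S = 0 \<or> S' = S)"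
    if "(t', S') \<in> tangent_rel p `` {(t, S)}" for t t' and S S' :: "'a direction"
    using that by (auto simp: tangent_rel_def)
  show ?thesis
    unfolding tangent_product_def
  proof (rule the_equality)
    show "\<exists>(t1', S1')\<in>tangent_rel p `` {(t1, S1)}. \<exists>(t2', S2')\<in>tangent_rel p `` {(t2, S2)}.
        t1 * t2 * dir_zeta S1 * dir_zeta S2 * cos (dir_angle p S1 S2)
        = t1' * t2' * dir_zeta S1' * dir_zeta S2' * cos (dir_angle p S1' S2')"
      using refl[OF assms(1,3)] refl[OF assms(2,4)] by blast
  next
    fix c assume "\<exists>(t1', S1')\<in>tangent_rel p `` {(t1, S1)}. \<exists>(t2', S2')\<in>tangent_rel p `` {(t2, S2)}.
        c = t1' * t2' * dir_zeta S1' * dir_zeta S2' * cos (dir_angle p S1' S2')"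
    then obtain t1' S1' t2' S2' where r:
        "(t1', S1') \<in> tangent_rel p `` {(t1, S1)}" "(t2', S2') \<in> tangent_rel p `` {(t2, S2)}"
      and c: "c = (t1' * dir_zeta S1') * (t2' * dir_zeta S2') * cos (dir_angle p S1' S2')"
      by (auto simp: mult_ac)
    have "c = (t1 * dir_zeta S1) * (t2 * dir_zeta S2) * cos (dir_angle p S1 S2)"
      using rep[OF r(1)] rep[OF r(2)] unfolding c by auto
    then show "c = t1 * t2 * dir_zeta S1 * dir_zeta S2 * cos (dir_angle p S1 S2)"
      by (simp add: mult_ac)
  qed
qed

text \<open>\<open>T\<close> is the scalar of a representative of \<open>v\<close>, since the zeta
  factors and the cosine have modulus at most 1. The bound is uniform in \<open>q\<close>, as needed
  when the resolvent moves.\<close>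

lemma tangent_product_geod_lower_bound:
  fixes v :: "'a::cat0_space tangent_vector"
  assumes "v \<in> tangent_space p"
  obtains T where "0 \<le> T" "\<And>q. - T \<le> tangent_product p v (tangent p 1 (geod p q))"
proof -
  obtain t S where t: "0 \<le> t" "S \<in> directions p" "v = tangent_rel p `` {(t, S)}"
    using assms by (auto simp: tangent_space_def elim!: quotientE)
  have "- t \<le> tangent_product p v (tangent p 1 (geod p q))" for q
  proof -
    let ?S = "direction p (geod p q)"
    have S: "?S \<in> directions p"
      by (simp add: direction_mem_directions geod_mem_geodesics_from)
    have "tangent_product p v (tangent p 1 (geod p q))
        = t * (dir_zeta S * dir_zeta ?S * cos (dir_angle p S ?S))"
      unfolding t(3) tangent_def by (simp add: tangent_product_eq t S mult_ac)
    moreover have "\<bar>dir_zeta S * dir_zeta ?S * cos (dir_angle p S ?S)\<bar> \<le> 1"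
      using dir_zeta_bounds[OF t(2)] dir_zeta_bounds[OF S]
      unfolding abs_mult by (intro mult_le_one) auto
    then have "-1 \<le> dir_zeta S * dir_zeta ?S * cos (dir_angle p S ?S)"
      by linarith
    then have "t * (-1) \<le> t * (dir_zeta S * dir_zeta ?S * cos (dir_angle p S ?S))"
      using t(1) by (rule mult_left_mono)
    ultimately show ?thesis by simp
  qed
  with t(1) that show thesis by blast
qed

text \<open>
  Multiplying the law of cosines through by the side lengths makes it hold for degenerate
  triangles too, where the product vanishes.
\<close>

lemma tangent_product_law_of_cosines:
  fixes p x q :: "'a::cat0_space"
  assumes "0 \<le> t"
  shows "t * ((dist p x)\<^sup>2 + (dist p q)\<^sup>2 - (dist x q)\<^sup>2)
    \<le> 2 * dist p x * dist p q * tangent_product p (tangent p t (geod p x)) (tangent p 1 (geod p q))"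
proof (cases "p = x \<or> p = q")
  case True
  then show ?thesis by (auto simp: dist_commute)
next
  case False
  then have z: "zeta (geod p x) \<noteq> 0" "zeta (geod p q) \<noteq> 0"
    by (simp_all add: zeta_geod)
  let ?\<alpha> = "alexandrov_angle p (geod p x) (geod p q)"
  note m = geod_mem_geodesics_from[of p]
  have prod: "tangent_product p (tangent p t (geod p x)) (tangent p 1 (geod p q)) = t * cos ?\<alpha>"
    unfolding tangent_def using assms False
    by (simp add: tangent_product_eq direction_mem_directions m dir_zeta_direction zeta_geod
        dir_angle_direction)
  \<comment> \<open>Curvature enters here: the Alexandrov angle is at most the comparison
    angle.\<close>
  have "cos_angle p x q \<le> cos ?\<alpha>"
    using alexandrov_angle_limit(2)[OF m m z] by (simp add: geod_properties)
  then have "(2 * dist p x * dist p q) * cos_angle p x q \<le> (2 * dist p x * dist p q) * cos ?\<alpha>"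
    by (intro mult_left_mono) auto
  then have "(dist p x)\<^sup>2 + (dist p q)\<^sup>2 - (dist x q)\<^sup>2 \<le> (2 * dist p x * dist p q) * cos ?\<alpha>"
    using False by (simp add: cos_angle_def)
  then have "t * ((dist p x)\<^sup>2 + (dist p q)\<^sup>2 - (dist x q)\<^sup>2) \<le> t * ((2 * dist p x * dist p q) * cos ?\<alpha>)"
    using assms by (rule mult_left_mono)
  then show ?thesis
    unfolding prod by (simp add: mult_ac)
qed


section \<open>Resolvents\<close>

text \<open>This is the law of cosines for the scalar d(z,x)/\<mu>, divided by that scalar. If
  \<open>z = x\<close> the scalar is 0 and division fails, but then both sides vanish.\<close>

lemma resolvent_vector_law_of_cosines:
  fixes z x q :: "'a::cat0_space"
  assumes "0 < \<mu>"
  shows "(dist z x)\<^sup>2 + (dist z q)\<^sup>2 - (dist x q)\<^sup>2 \<le> 2 * \<mu> * dist z q *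
    tangent_product z (tangent z (inverse \<mu> * dist z x) (geod z x)) (tangent z 1 (geod z q))"
    (is "?K \<le> 2 * \<mu> * dist z q * ?P")
proof (cases "z = x")
  case True
  have "?P = 0"
    unfolding tangent_def
    by (simp add: True tangent_product_eq direction_mem_directions geod_mem_geodesics_from)
  with True show ?thesis by (simp add: dist_commute)
next
  case False
  have "inverse \<mu> * dist z x * ?K \<le> 2 * dist z x * dist z q * ?P"
    using assms by (intro tangent_product_law_of_cosines) simp
  then have "(inverse \<mu> * dist z x) * ?K \<le> (inverse \<mu> * dist z x) * (2 * \<mu> * dist z q * ?P)"
    using assms by (simp add: field_simps)
  moreover have "0 < inverse \<mu> * dist z x"
    using assms False by simp
  ultimately show ?thesis
    by (simp only: mult_le_cancel_left_pos)
qed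

text \<open>Adding the laws of cosines at \<open>z\<close> and at \<open>w\<close> cancels the
  distances to \<open>x\<close> and leaves twice the squared distance of \<open>z\<close> and
  \<open>w\<close>, while monotonicity makes the sum of the products nonpositive.\<close>

lemma resolvent_set_unique:
  fixes A :: "'a::cat0_space \<Rightarrow> 'a tangent_vector set"
  assumes "monotone_vf A" "0 < \<mu>" "z \<in> resolvent_set A \<mu> x" "w \<in> resolvent_set A \<mu> x"
  shows "z = w"
proof -
  let ?P = "tangent_product z (tangent z (inverse \<mu> * dist z x) (geod z x)) (tangent z 1 (geod z w))"
  let ?Q = "tangent_product w (tangent w (inverse \<mu> * dist w x) (geod w x)) (tangent w 1 (geod w z))"
  have "?P + ?Q \<le> 0"
    using assms unfolding monotone_vf_def resolvent_set_def by force
  then have "2 * \<mu> * dist z w * (?P + ?Q) \<le> 0"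
    using assms(2) by (intro mult_nonneg_nonpos) auto
  moreover have "(dist z x)\<^sup>2 + (dist z w)\<^sup>2 - (dist x w)\<^sup>2 \<le> 2 * \<mu> * dist z w * ?P"
    by (rule resolvent_vector_law_of_cosines[OF assms(2)])
  moreover have "(dist w x)\<^sup>2 + (dist z w)\<^sup>2 - (dist x z)\<^sup>2 \<le> 2 * \<mu> * dist z w * ?Q"
    using resolvent_vector_law_of_cosines[OF assms(2), of w x z] by (simp add: dist_commute)
  ultimately have "2 * (dist z w)\<^sup>2 \<le> 0"
    unfolding dist_commute[of x] distrib_left by linarith
  then show ?thesis by simp
qed

lemma resolvent_mem:
  fixes A :: "'a::cat0_space \<Rightarrow> 'a tangent_vector set"
  assumes "monotone_vf A" "surjectivity_condition A" "0 < \<mu>"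
  shows "resolvent A \<mu> x \<in> resolvent_set A \<mu> x"
proof -
  have "0 < inverse \<mu>" using assms(3) by simp
  then obtain z where z: "z \<in> resolvent_set A \<mu> x"
    using assms(2) unfolding surjectivity_condition_def resolvent_set_def by blast
  then have "resolvent_set A \<mu> x = {z}"
    using resolvent_set_unique[OF assms(1,3)] by blast
  then show ?thesis
    by (simp add: resolvent_def)
qed

lemma resolvent_mem_vf_dom:
  fixes A :: "'a::cat0_space \<Rightarrow> 'a tangent_vector set"
  assumes "monotone_vf A" "surjectivity_condition A" "0 < \<mu>"
  shows "resolvent A \<mu> x \<in> vf_dom A"
  using resolvent_mem[OF assms, of x] by (auto simp: resolvent_set_def vf_dom_def)

text \<open>One vector \<open>v\<close> at \<open>q\<close> is fixed before \<mu>, so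
  \<open>T\<close> does not depend on \<mu>. Monotonicity bounds the product at the resolvent by
  minus the product at \<open>q\<close>, hence by \<open>T\<close>.\<close>

lemma resolvent_estimate:
  fixes A :: "'a::cat0_space \<Rightarrow> 'a tangent_vector set"
  assumes "vector_field A" "monotone_vf A" "surjectivity_condition A" "q \<in> vf_dom A"
  obtains T where "\<And>\<mu>. 0 < \<mu> \<Longrightarrow> (dist (resolvent A \<mu> x) x)\<^sup>2 + (dist (resolvent A \<mu> x) q)\<^sup>2
      \<le> (dist x q)\<^sup>2 + 2 * \<mu> * T * dist (resolvent A \<mu> x) q" "0 \<le> T"
proof -
  obtain v where v: "v \<in> A q" using assms(4) by (auto simp: vf_dom_def)
  then have "v \<in> tangent_space q" using assms(1) by (auto simp: vector_field_def)
  then obtain T where T: "0 \<le> T" "\<And>z. - T \<le> tangent_product q v (tangent q 1 (geod q z))"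
    using tangent_product_geod_lower_bound by blast
  have "(dist z x)\<^sup>2 + (dist z q)\<^sup>2 \<le> (dist x q)\<^sup>2 + 2 * \<mu> * T * dist z q"
    if \<mu>: "0 < \<mu>" and z: "z = resolvent A \<mu> x" for \<mu> z
  proof -
    let ?P = "tangent_product z (tangent z (inverse \<mu> * dist z x) (geod z x)) (tangent z 1 (geod z q))"
    have "tangent z (inverse \<mu> * dist z x) (geod z x) \<in> A z"
      using resolvent_mem[OF assms(2,3) \<mu>, of x] z by (simp add: resolvent_set_def)
    then have "?P \<le> - tangent_product q v (tangent q 1 (geod q z))"
      using assms(2) v by (auto simp: monotone_vf_def)
    with T(2)[of z] have "?P \<le> T" by linarith
    then have "2 * \<mu> * dist z q * ?P \<le> 2 * \<mu> * dist z q * T"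
      using \<mu> by (intro mult_left_mono) auto
    with resolvent_vector_law_of_cosines[OF \<mu>, of z x q] show ?thesis
      by (simp add: mult_ac)
  qed
  with T(1) that show thesis by blast
qed

section \<open>Convergence of the resolvents to nearest points\<close>

text \<open>If \<open>w\<close> exceeded \<open>b + e\<close>, both factors of
  \<open>w * (w - b)\<close> would exceed \<open>e\<close>.\<close>

lemma quadratic_le_imp_le:
  fixes w b e :: real
  assumes "w\<^sup>2 \<le> e\<^sup>2 + b * w" "0 \<le> b" "0 \<le> e"
  shows "w \<le> b + e"
proof (rule ccontr)
  assume "\<not> w \<le> b + e"
  then have w: "b + e < w" by simp
  then have "e * e \<le> w * (w - b)"
    using assms by (intro mult_mono) auto
  moreover have "e * e < w * (w - b)"
  proof (cases "e = 0")
    case True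
    with w assms show ?thesis by simp
  next
    case False
    with w assms show ?thesis by (intro mult_strict_mono) auto
  qed
  ultimately show False
    using assms(1) by (simp add: power2_eq_square algebra_simps)
qed

lemma resolvent_dist_bound:
  fixes A :: "'a::cat0_space \<Rightarrow> 'a tangent_vector set" and x q :: 'a
  assumes "vector_field A" "monotone_vf A" "surjectivity_condition A" "q \<in> vf_dom A"
  defines "e \<equiv> sqrt ((dist x q)\<^sup>2 - (infdist x (vf_dom A))\<^sup>2)"
  obtains T where "\<And>\<mu>. 0 < \<mu> \<Longrightarrow> dist (resolvent A \<mu> x) q \<le> \<mu> * T + e"
proof -
  let ?D = "infdist x (vf_dom A)"
  obtain T where T: "0 \<le> T" "\<And>\<mu>. 0 < \<mu> \<Longrightarrow> (dist (resolvent A \<mu> x) x)\<^sup>2 + (dist (resolvent A \<mu> x) q)\<^sup>2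
      \<le> (dist x q)\<^sup>2 + 2 * \<mu> * T * dist (resolvent A \<mu> x) q"
    using resolvent_estimate[OF assms(1-4)] by metis
  have D: "?D\<^sup>2 \<le> (dist y x)\<^sup>2" if "y \<in> vf_dom A" for y
    using infdist_le[OF that, of x] by (intro power_mono) (auto simp: dist_commute infdist_nonneg)
  have "0 \<le> (dist x q)\<^sup>2 - ?D\<^sup>2"
    using D[OF assms(4)] by (simp add: dist_commute)
  \<comment> \<open>\<open>e\<close> squares back to the radicand because \<open>q\<close> lies in
    the domain and so is at distance at least \<open>?D\<close> from \<open>x\<close>.\<close>
  then have e: "0 \<le> e" "e\<^sup>2 = (dist x q)\<^sup>2 - ?D\<^sup>2"
    by (simp_all add: e_def)
  have "dist (resolvent A \<mu> x) q \<le> \<mu> * (2 * T) + e" if \<mu>: "0 < \<mu>" for \<mu>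
  proof (rule quadratic_le_imp_le)
    show "(dist (resolvent A \<mu> x) q)\<^sup>2 \<le> e\<^sup>2 + \<mu> * (2 * T) * dist (resolvent A \<mu> x) q"
      using T(2)[OF \<mu>] D[OF resolvent_mem_vf_dom[OF assms(2,3) \<mu>, of x]] e(2)
      by (simp add: mult_ac)
  qed (use \<mu> T e in auto)
  with that show thesis by blast
qed

lemma resolvent_dist_eventually_less:
  fixes A :: "'a::cat0_space \<Rightarrow> 'a tangent_vector set"
  assumes "vector_field A" "monotone_vf A" "surjectivity_condition A" "q \<in> vf_dom A"
    and "sqrt ((dist x q)\<^sup>2 - (infdist x (vf_dom A))\<^sup>2) < \<epsilon>"
  shows "eventually (\<lambda>\<mu>. dist (resolvent A \<mu> x) q < \<epsilon>) (at_right 0)"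
proof -
  let ?e = "sqrt ((dist x q)\<^sup>2 - (infdist x (vf_dom A))\<^sup>2)"
  obtain T where T: "\<And>\<mu>. 0 < \<mu> \<Longrightarrow> dist (resolvent A \<mu> x) q \<le> \<mu> * T + ?e"
    using resolvent_dist_bound[OF assms(1-4)] by metis
  have "((\<lambda>\<mu>. \<mu> * T + ?e) \<longlongrightarrow> 0 * T + ?e) (at_right 0)"
    by (intro tendsto_intros)
  then have "eventually (\<lambda>\<mu>. \<mu> * T + ?e < \<epsilon>) (at_right 0)"
    using assms(5) by (intro order_tendstoD(2)) auto
  with eventually_at_right_less[of "0::real"] show ?thesis
    by eventually_elim (use T in \<open>meson le_less_trans\<close>)
qed

text \<open>At a point \<open>y\<close> of the closure the field may be empty, so the estimate is
  applied at nearby points \<open>f n\<close> of the domain; their error term tends to that of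
  \<open>y\<close>, which is at most 0.\<close>

lemma resolvent_tendsto_minimizer:
  fixes A :: "'a::cat0_space \<Rightarrow> 'a tangent_vector set"
  assumes A: "vector_field A" "monotone_vf A" "surjectivity_condition A"
    and y: "y \<in> closure (vf_dom A)" "dist x y \<le> infdist x (vf_dom A)"
  shows "((\<lambda>\<mu>. resolvent A \<mu> x) \<longlongrightarrow> y) (at_right 0)"
proof (rule tendstoI)
  fix \<epsilon> :: real assume \<epsilon>: "0 < \<epsilon>"
  let ?D = "infdist x (vf_dom A)"
  obtain f where f: "\<And>n. f n \<in> vf_dom A" "f \<longlonglongrightarrow> y"
    using y(1) by (auto simp: closure_sequential)
  have "(dist x y)\<^sup>2 \<le> ?D\<^sup>2"
    using y(2) by (intro power_mono) auto
  then have "sqrt ((dist x y)\<^sup>2 - ?D\<^sup>2) + dist y y < \<epsilon>"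
    using \<epsilon> by (simp add: le_less_trans[of _ 0])
  moreover have "(\<lambda>n. sqrt ((dist x (f n))\<^sup>2 - ?D\<^sup>2) + dist (f n) y)
      \<longlonglongrightarrow> sqrt ((dist x y)\<^sup>2 - ?D\<^sup>2) + dist y y"
    by (intro tendsto_intros f)
  ultimately have "eventually (\<lambda>n. sqrt ((dist x (f n))\<^sup>2 - ?D\<^sup>2) + dist (f n) y < \<epsilon>) sequentially"
    by (rule order_tendstoD(2)[rotated])
  then obtain n where "sqrt ((dist x (f n))\<^sup>2 - ?D\<^sup>2) + dist (f n) y < \<epsilon>"
    using eventually_happens'[OF sequentially_bot] by blast
  then have n: "sqrt ((dist x (f n))\<^sup>2 - ?D\<^sup>2) < \<epsilon> - dist (f n) y"
    by linarith
  have "eventually (\<lambda>\<mu>. dist (resolvent A \<mu> x) (f n) < \<epsilon> - dist (f n) y) (at_right 0)"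
    by (rule resolvent_dist_eventually_less[OF A f(1) n])
  then show "eventually (\<lambda>\<mu>. dist (resolvent A \<mu> x) y < \<epsilon>) (at_right 0)"
  proof (rule eventually_mono)
    fix \<mu> assume "dist (resolvent A \<mu> x) (f n) < \<epsilon> - dist (f n) y"
    then show "dist (resolvent A \<mu> x) y < \<epsilon>"
      using dist_triangle[of "resolvent A \<mu> x" y "f n"] by linarith
  qed
qed

lemma minimizer_exists:
  fixes A :: "'a::{cat0_space, complete_space} \<Rightarrow> 'a tangent_vector set"
  assumes A: "vector_field A" "monotone_vf A" "surjectivity_condition A"
  obtains y where "y \<in> closure (vf_dom A)" "dist x y = infdist x (vf_dom A)"
proof -
  let ?D = "infdist x (vf_dom A)"
  define e where "e q = sqrt ((dist x q)\<^sup>2 - ?D\<^sup>2)" for q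
  \<comment> \<open>Any resolvent lies in the domain. On the empty set \<open>infdist\<close> would
    be the default value 0.\<close>
  have ne: "vf_dom A \<noteq> {}"
    using resolvent_mem_vf_dom[OF A(2,3), of 1] by auto
  have "\<exists>q\<in>vf_dom A. dist x q < ?D + inverse (Suc n)" for n
  proof -
    have "(INF q\<in>vf_dom A. dist x q) < ?D + inverse (real (Suc n))"
      using ne by (simp add: infdist_def)
    then show ?thesis
      using ne by (subst (asm) cINF_less_iff) auto
  qed
  then obtain f where f: "\<And>n. f n \<in> vf_dom A" "\<And>n. dist x (f n) < ?D + inverse (Suc n)"
    by metis
  have "(\<lambda>n. dist x (f n)) \<longlonglongrightarrow> ?D"
  proof (rule tendsto_sandwich[OF _ _ tendsto_const])
    show "(\<lambda>n. ?D + inverse (real (Suc n))) \<longlonglongrightarrow> ?D"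
      using tendsto_add[OF tendsto_const LIMSEQ_inverse_real_of_nat, of ?D] by simp
  qed (use f in \<open>auto simp: infdist_le intro!: always_eventually less_imp_le\<close>)
  then have "(\<lambda>n. e (f n)) \<longlonglongrightarrow> sqrt (?D\<^sup>2 - ?D\<^sup>2)"
    unfolding e_def by (intro tendsto_intros)
  then have e0: "(\<lambda>n. e (f n)) \<longlonglongrightarrow> 0" by simp
  have "Cauchy f"
  proof (rule metric_CauchyI)
    fix \<epsilon> :: real assume "0 < \<epsilon>"
    then have "eventually (\<lambda>n. e (f n) < \<epsilon> / 2) sequentially"
      using e0 by (intro order_tendstoD(2)) auto
    then obtain N where N: "\<And>n. n \<ge> N \<Longrightarrow> e (f n) < \<epsilon> / 2"
      by (auto simp: eventually_sequentially)
    have "dist (f m) (f n) < \<epsilon>" if "m \<ge> N" "n \<ge> N" for m n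
    proof -
      have ev: "eventually (\<lambda>\<mu>. dist (resolvent A \<mu> x) (f k) < \<epsilon> / 2) (at_right 0)" if "k \<ge> N" for k
        using N[OF that] by (intro resolvent_dist_eventually_less[OF A f(1)]) (simp add: e_def)
      \<comment> \<open>For small \<mu> a single resolvent is within \<epsilon>/2 of both points.
        The conclusion is free of \<mu>, so it holds outright because the filter is proper.\<close>
      have "eventually (\<lambda>\<mu>::real. dist (f m) (f n) < \<epsilon>) (at_right 0)"
        using ev[OF that(1)] ev[OF that(2)]
        by eventually_elim (rule dist_triangle_half_r)
      then show ?thesis
        by (simp add: trivial_limit_at_right_real)
    qed
    then show "\<exists>M. \<forall>m\<ge>M. \<forall>n\<ge>M. dist (f m) (f n) < \<epsilon>" by blast
  qed
  then obtain y where y: "f \<longlonglongrightarrow> y"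
    using Cauchy_convergent_iff convergent_def by blast
  then have "(\<lambda>n. dist x (f n)) \<longlonglongrightarrow> dist x y"
    by (intro tendsto_intros)
  with \<open>(\<lambda>n. dist x (f n)) \<longlonglongrightarrow> ?D\<close> have "dist x y = ?D"
    by (rule LIMSEQ_unique[rotated])
  moreover have "y \<in> closure (vf_dom A)"
    using f(1) y by (auto simp: closure_sequential)
  ultimately show thesis using that by blast
qed

theorem theorem4p11:
  fixes A :: "'a::{cat0_space, complete_space} \<Rightarrow> 'a tangent_vector set"
  assumes "geodesic_extension_property TYPE('a)"
    and "vector_field A"
    and "monotone_vf A"
    and "surjectivity_condition A"
  shows "\<forall>x. ((\<lambda>\<mu>. resolvent A \<mu> x) \<longlongrightarrow> nearest_point (closure (vf_dom A)) x) (at_right 0)"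
proof
  fix x
  obtain y where y: "y \<in> closure (vf_dom A)" "dist x y = infdist x (vf_dom A)"
    using minimizer_exists[OF assms(2-4)] by blast
  have lim: "((\<lambda>\<mu>. resolvent A \<mu> x) \<longlongrightarrow> y') (at_right 0)"
    if "y' \<in> closure (vf_dom A)" "dist x y' \<le> dist x y" for y'
    using resolvent_tendsto_minimizer[OF assms(2-4), of y' x] that y(2) by simp
  \<comment> \<open>\<open>infdist\<close> to the domain is 1-Lipschitz and vanishes on the closure,
    so the infimum over the domain also bounds distances to closure points.\<close>
  have "dist x y \<le> dist x z" if "z \<in> closure (vf_dom A)" for z
    using infdist_triangle[of x "vf_dom A" z] in_closure_iff_infdist_zero[of "vf_dom A" z] that y
    by (cases "vf_dom A = {}") auto
  then have "nearest_point (closure (vf_dom A)) x = y"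
    unfolding nearest_point_def
  proof (intro the_equality)
    \<comment> \<open>A second nearest point would be a limit of the same resolvents.\<close>
    fix y' assume y': "y' \<in> closure (vf_dom A) \<and> (\<forall>z\<in>closure (vf_dom A). dist x y' \<le> dist x z)"
    with y(1) have "((\<lambda>\<mu>. resolvent A \<mu> x) \<longlongrightarrow> y') (at_right 0)"
      by (intro lim) auto
    then show "y' = y"
      using lim[OF y(1) order_refl] by (rule tendsto_unique[OF trivial_limit_at_right_real])
  qed (use y(1) in blast)
  with lim[OF y(1) order_refl] show "((\<lambda>\<mu>. resolvent A \<mu> x) \<longlongrightarrow> nearest_point (closure (vf_dom A)) x) (at_right 0)"
    by simp
qed

end
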